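(* For every $n\ge 0$, the Hankel determinant $H_{n}(\alpha_{k}(x))$ is a polynomial in $x$ of degree $n(n+1)$ with leading coefficient \begin{equation*} \big[x^{n(n+1)}\big]H_{n}(\alpha_{k}(x))=\alpha_{0}^{n+1}(-1)^{\binom{n+1}{2}}q^{3\binom{n+1}{3}}\prod_{j=1}^{n}(1-q^{j})^{n+1-j}. \end{equation*}
   Context: For a sequence $(a_k)_{k\ge0}$, $H_n(a_k):=\det_{0\le i,j\le n}(a_{i+j})$ denotes its $n$-th Hankel determinant. The $q$-Pochhammer symbol is $(A;q)_N:=\prod_{k=0}^{N-1}(1-Aq^k)$, and the $q$-binomial coefficient is $\genfrac{[}{]}{0pt}{}{n}{k}_q:=\frac{(q;q)_n}{(q;q)_k(q;q)_{n-k}}$ for $0\le k\le n$ and $0$ otherwise. Let $(\alpha_k)_{k\ge0}$ be an arbitrary sequence and define the polynomials \begin{align*} \alpha_{k}(x):=\sum_{\ell=0}^{k}q^{\binom{\ell}{2}}\genfrac{[}{]}{0pt}{}{k}{\ell}_{q}\alpha_{k-\ell}x^{\ell}. \end{align*}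
   Formalization: The degree is shown to be at most n(n+1), and exactly n(n+1) when α_0 and q are nonzero (for α_0=0, n=1 the determinant is −α_1², so exact degree fails); the coefficient formula holds for every sequence; q is not a root of unity, so the q-binomials are defined. *)

theory Defs
  imports "Jordan_Normal_Form.Determinant" "HOL-Computational_Algebra.Polynomial"
begin

text \<open>The index \<open>n\<close> is the largest row index: this is the determinant of an
  \<open>(n+1) \<times> (n+1)\<close> matrix.\<close>

definition hankel_det :: "nat \<Rightarrow> (nat \<Rightarrow> 'a::comm_ring_1) \<Rightarrow> 'a" where
  "hankel_det n a = det (mat (n + 1) (n + 1) (\<lambda>(i, j). a (i + j)))"

definition q_pochhammer :: "'a::comm_ring_1 \<Rightarrow> 'a \<Rightarrow> nat \<Rightarrow> 'a" where
  "q_pochhammer A q N = (\<Prod>k<N. 1 - A * q ^ k)"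

text \<open>The quotient is meaningful only if \<open>q ^ j \<noteq> 1\<close> for \<open>1 \<le> j \<le> n\<close>.\<close>

definition q_binomial :: "'a::field \<Rightarrow> nat \<Rightarrow> nat \<Rightarrow> 'a" where
  "q_binomial q n k =
    (if k \<le> n then q_pochhammer q q n / (q_pochhammer q q k * q_pochhammer q q (n - k)) else 0)"

definition alpha_poly :: "'a::field \<Rightarrow> (nat \<Rightarrow> 'a) \<Rightarrow> nat \<Rightarrow> 'a poly" where
  "alpha_poly q \<alpha> k =
    (\<Sum>l\<le>k. monom (q ^ (l choose 2) * q_binomial q k l * \<alpha> (k - l)) l)"

end

theory Submission
  imports Defs
begin

text \<open>The entry \<open>(i, j)\<close> of the Hankel matrix has degree at most \<open>i + j\<close> in \<open>x\<close>, so every term of the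
  Leibniz expansion has degree at most \<open>n (n + 1)\<close>, and the coefficient there is the determinant of
  the matrix of the coefficients of \<open>x ^ (i + j)\<close>, which are \<open>\<alpha> 0 * q ^ ((i + j) choose 2)\<close>. Since
  \<open>(i + j) choose 2 = (i choose 2) + (j choose 2) + i * j\<close>, that matrix is a row and column
  rescaling of the Vandermonde matrix with nodes \<open>q ^ i\<close>.\<close>

text \<open>In the convolution only the index \<open>a\<close> survives: below it the second index
  exceeds \<open>b\<close>, above it \<open>coeff p\<close> vanishes. Working with bounds instead of
  exact degrees allows zero divisors and vanishing top coefficients.\<close>

lemma degree_mult_le_bounds:
  fixes p r :: "'a::comm_semiring_1 poly"
  assumes "degree p \<le> a" "degree r \<le> b"
  shows "degree (p * r) \<le> a + b" and "coeff (p * r) (a + b) = coeff p a * coeff r b"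
proof -
  show "degree (p * r) \<le> a + b"
    using degree_mult_le[of p r] assms by linarith
  have "coeff (p * r) (a + b) = (\<Sum>i\<le>a + b. if i = a then coeff p a * coeff r b else 0)"
    unfolding coeff_mult
  proof (rule sum.cong[OF refl])
    fix i assume "i \<in> {..a + b}"
    show "coeff p i * coeff r (a + b - i) = (if i = a then coeff p a * coeff r b else 0)"
    proof (cases i a rule: linorder_cases)
      case less
      then have "degree r < a + b - i" using assms(2) by linarith
      then show ?thesis using less by (simp add: coeff_eq_0)
    next
      case greater
      then show ?thesis using assms(1) by (simp add: coeff_eq_0)
    qed simp
  qed
  then show "coeff (p * r) (a + b) = coeff p a * coeff r b" by simp
qed

lemma degree_prod_le_bounds:
  fixes f :: "'b \<Rightarrow> 'a::comm_semiring_1 poly"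
  assumes "finite A" "\<And>i. i \<in> A \<Longrightarrow> degree (f i) \<le> d i"
  shows "degree (\<Prod>i\<in>A. f i) \<le> (\<Sum>i\<in>A. d i) \<and>
    coeff (\<Prod>i\<in>A. f i) (\<Sum>i\<in>A. d i) = (\<Prod>i\<in>A. coeff (f i) (d i))"
  using assms
proof (induction A rule: finite_induct)
  case (insert a A)
  then show ?case
    using degree_mult_le_bounds[of "f a" "d a" "\<Prod>i\<in>A. f i" "\<Sum>i\<in>A. d i"] by simp
qed simp

text \<open>A permutation only reorders the column weights, so when the degree bound of an entry
  splits into a row part and a column part, all Leibniz terms share the bound \<open>D\<close>. The
  coefficient at \<open>D\<close> can then be taken entrywise.\<close>

lemma det_degree_bounds:
  fixes A :: "nat \<Rightarrow> nat \<Rightarrow> 'a::comm_ring_1 poly" and r s :: "nat \<Rightarrow> nat"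
  assumes deg: "\<And>i j. i < n \<Longrightarrow> j < n \<Longrightarrow> degree (A i j) \<le> r i + s j"
  defines "D \<equiv> (\<Sum>i<n. r i) + (\<Sum>j<n. s j)"
  shows "degree (det (mat n n (\<lambda>(i, j). A i j))) \<le> D"
    and "coeff (det (mat n n (\<lambda>(i, j). A i j))) D =
      det (mat n n (\<lambda>(i, j). coeff (A i j) (r i + s j)))"
proof -
  let ?P = "{p. p permutes {0..<n}}"
  have lt: "p i < n" if "p permutes {0..<n}" "i < n" for p i
    using permutes_in_image[OF that(1), of i] that(2) by simp
  have det: "det (mat n n (\<lambda>(i, j). B i j)) =
      (\<Sum>p\<in>?P. signof p * (\<Prod>i = 0..<n. B i (p i)))" for B :: "nat \<Rightarrow> nat \<Rightarrow> 'b::comm_ring_1"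
    by (subst det_def'[of _ n]) (auto intro!: sum.cong prod.cong simp: lt)
  have prod: "degree (\<Prod>i = 0..<n. A i (p i)) \<le> D \<and>
      coeff (\<Prod>i = 0..<n. A i (p i)) D = (\<Prod>i = 0..<n. coeff (A i (p i)) (r i + s (p i)))"
    if p: "p permutes {0..<n}" for p
  proof -
    have "(\<Sum>i = 0..<n. s (p i)) = (\<Sum>i = 0..<n. s i)"
      using sum.permute[OF p, of s] by (simp add: o_def)
    then have D: "D = (\<Sum>i = 0..<n. r i + s (p i))"
      by (simp add: D_def sum.distrib lessThan_atLeast0)
    show ?thesis unfolding D
      by (rule degree_prod_le_bounds) (simp_all add: deg lt[OF p])
  qed
  \<comment> \<open>The sign on the left is a constant polynomial; as a scalar it commutes with
    \<open>coeff\<close> and cannot raise the degree.\<close>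
  have sgn: "signof p * f = smult (signof p) f" for p and f :: "'a poly"
    by (simp add: sign_def)
  show "degree (det (mat n n (\<lambda>(i, j). A i j))) \<le> D"
    unfolding det sgn
    by (intro degree_sum_le finite_permutations order_trans[OF degree_smult_le])
      (use prod in auto)
  show "coeff (det (mat n n (\<lambda>(i, j). A i j))) D =
      det (mat n n (\<lambda>(i, j). coeff (A i j) (r i + s j)))"
    unfolding det sgn by (simp add: coeff_sum prod)
qed

text \<open>Each Leibniz term uses every row and every column exactly once, so it contains every
  \<open>r i\<close> and every \<open>s j\<close> once.\<close>

lemma det_scale_rows_cols:
  fixes A :: "nat \<Rightarrow> nat \<Rightarrow> 'a::comm_ring_1" and r s :: "nat \<Rightarrow> 'a"
  shows "det (mat n n (\<lambda>(i, j). r i * s j * A i j)) =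
    (\<Prod>i<n. r i) * (\<Prod>j<n. s j) * det (mat n n (\<lambda>(i, j). A i j))"
proof -
  have lt: "p i < n" if "p permutes {0..<n}" "i < n" for p i
    using permutes_in_image[OF that(1), of i] that(2) by simp
  have "signof p * (\<Prod>i = 0..<n. r i * s (p i) * A i (p i)) =
      (\<Prod>i<n. r i) * (\<Prod>j<n. s j) * (signof p * (\<Prod>i = 0..<n. A i (p i)))"
    if p: "p permutes {0..<n}" for p
    using prod.permute[OF p, of s] by (simp add: prod.distrib lessThan_atLeast0 o_def mult_ac)
  then show ?thesis
    by (subst (1 2) det_def'[of _ n])
      (auto simp: lt sum_distrib_left intro!: sum.cong)
qed

text \<open>The coefficients \<open>c k j\<close> of the Newton expansion
  \<open>t ^ j = (\<Sum>k\<le>j. c k j * (\<Prod>l<k. t - x l))\<close>.\<close>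

fun newton_coeff :: "(nat \<Rightarrow> 'a::comm_ring_1) \<Rightarrow> nat \<Rightarrow> nat \<Rightarrow> 'a" where
  "newton_coeff x 0 0 = 1"
| "newton_coeff x (Suc k) 0 = 0"
| "newton_coeff x 0 (Suc j) = x 0 * newton_coeff x 0 j"
| "newton_coeff x (Suc k) (Suc j) = x (Suc k) * newton_coeff x (Suc k) j + newton_coeff x k j"

lemma newton_coeff_eq_0: "j < k \<Longrightarrow> newton_coeff x k j = 0"
  by (induction x k j rule: newton_coeff.induct) auto

lemma newton_coeff_diag: "newton_coeff x k k = 1"
  by (induction k) (auto simp: newton_coeff_eq_0)

text \<open>Multiply the expansion of \<open>t ^ j\<close> by \<open>t\<close> and write
  \<open>t = x k + (t - x k)\<close> in the \<open>k\<close>-th term; regrouping gives the recursion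
  of \<open>newton_coeff\<close>.\<close>

lemma newton_expansion:
  assumes "j < n"
  shows "t ^ j = (\<Sum>k<n. (\<Prod>l<k. t - x l) * newton_coeff x k j)"
  using assms
proof (induction j)
  case 0
  then obtain m where n: "n = Suc m" by (cases n) auto
  show ?case unfolding n by (subst sum.lessThan_Suc_shift) simp
next
  case (Suc j)
  then obtain m where n: "n = Suc m" by (cases n) auto
  let ?N = "\<lambda>k. \<Prod>l<k. t - x l"
  let ?c = "newton_coeff x"
  \<comment> \<open>Multiplication by \<open>t\<close> would produce the Newton product of index
    \<open>n\<close>, outside the range; its coefficient vanishes because
    \<open>j < m\<close>.\<close>
  have top: "?c m j = 0" using Suc.prems n by (simp add: newton_coeff_eq_0)
  have "t ^ Suc j = (\<Sum>k<n. t * (?N k * ?c k j))"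
    using Suc by (simp add: sum_distrib_left)
  also have "\<dots> = (\<Sum>k<n. ?N k * (x k * ?c k j)) + (\<Sum>k<n. ?N (Suc k) * ?c k j)"
    by (simp add: sum.distrib[symmetric] algebra_simps)
  also have "(\<Sum>k<n. ?N (Suc k) * ?c k j) = (\<Sum>k<m. ?N (Suc k) * ?c k j)"
    by (simp add: n top)
  also have "(\<Sum>k<n. ?N k * (x k * ?c k j)) + \<dots> = (\<Sum>k<n. ?N k * ?c k (Suc j))"
    unfolding n sum.lessThan_Suc_shift[where n = m]
    by (simp add: sum.distrib[symmetric] algebra_simps)
  finally show ?case .
qed

text \<open>Newton expansion at \<open>t = x i\<close> is an LU factorization. For
  \<open>k > i\<close> the entry of \<open>?L\<close> contains the factor \<open>x i - x i\<close>,
  and \<open>?U\<close> is unit upper triangular, so the diagonal of \<open>?L\<close> gives the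
  determinant.\<close>

lemma det_vandermonde:
  fixes x :: "nat \<Rightarrow> 'a::comm_ring_1"
  shows "det (mat n n (\<lambda>(i, j). x i ^ j)) = (\<Prod>j<n. \<Prod>i<j. x j - x i)"
proof -
  let ?L = "mat n n (\<lambda>(i, k). \<Prod>l<k. x i - x l)"
  let ?U = "mat n n (\<lambda>(k, j). newton_coeff x k j)"
  have "mat n n (\<lambda>(i, j). x i ^ j) = ?L * ?U"
    by (rule eq_matI)
      (auto simp: scalar_prod_def newton_expansion[where x = x and n = n] lessThan_atLeast0)
  then have "det (mat n n (\<lambda>(i, j). x i ^ j)) = det ?L * det ?U"
    by (simp add: det_mult[of _ n])
  also have "det ?L = (\<Prod>j<n. \<Prod>i<j. x j - x i)"
    by (subst det_lower_triangular[of n])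
      (auto simp: prod_list_diag_prod lessThan_atLeast0 intro!: prod_zero)
  also have "det ?U = 1"
    by (subst det_upper_triangular[of _ n])
      (auto simp: prod_list_diag_prod newton_coeff_diag newton_coeff_eq_0)
  finally show ?thesis by simp
qed

text \<open>Take \<open>- (q ^ i)\<close> out of each factor and reverse the order of what
  remains.\<close>

lemma prod_diff_powers:
  fixes q :: "'a::comm_ring_1"
  shows "(\<Prod>i<m. q ^ m - q ^ i) = (- 1) ^ m * q ^ (m choose 2) * (\<Prod>j=1..m. 1 - q ^ j)"
proof -
  have "(\<Prod>i<m. q ^ m - q ^ i) = (\<Prod>i<m. (- 1) * q ^ i * (1 - q ^ (m - i)))"
    by (intro prod.cong) (auto simp: algebra_simps simp flip: power_add)
  also have "\<dots> = (- 1) ^ m * q ^ (\<Sum>i<m. i) * (\<Prod>i<m. 1 - q ^ (m - i))"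
    by (simp add: prod.distrib power_sum prod_uminus)
  also have "(\<Sum>i<m. i) = m choose 2"
    by (induction m) (auto simp: numeral_2_eq_2)
  also have "(\<Prod>i<m. 1 - q ^ (m - i)) = (\<Prod>j=1..m. 1 - q ^ j)"
    by (rule prod.reindex_bij_witness[where i = "\<lambda>j. m - j" and j = "\<lambda>i. m - i"]) auto
  finally show ?thesis .
qed

lemma prod_prod_diff_powers:
  fixes q :: "'a::comm_ring_1"
  shows "(\<Prod>j<Suc n. \<Prod>i<j. q ^ j - q ^ i) =
    (- 1) ^ (Suc n choose 2) * q ^ (Suc n choose 3) * (\<Prod>j=1..n. (1 - q ^ j) ^ (n + 1 - j))"
proof (induction n)
  case 0
  then show ?case by (simp add: numeral_2_eq_2 numeral_3_eq_3)
next
  case (Suc n)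
  \<comment> \<open>Every factor gains one power; at \<open>j = Suc n\<close> the old exponent
    \<open>n + 1 - j\<close> is 0, so the range of the old product may be extended.\<close>
  have "(\<Prod>j=1..Suc n. (1 - q ^ j) ^ (Suc n + 1 - j)) =
      (\<Prod>j=1..Suc n. (1 - q ^ j) ^ (n + 1 - j) * (1 - q ^ j))"
    by (intro prod.cong) (auto simp: Suc_diff_le simp flip: power_Suc2)
  then have P: "(\<Prod>j=1..Suc n. (1 - q ^ j) ^ (Suc n + 1 - j)) =
      (\<Prod>j=1..n. (1 - q ^ j) ^ (n + 1 - j)) * (\<Prod>j=1..Suc n. 1 - q ^ j)"
    by (simp add: prod.distrib mult_ac)
  have C: "Suc (Suc n) choose 2 = (Suc n choose 2) + Suc n"
    "Suc (Suc n) choose 3 = (Suc n choose 3) + (Suc n choose 2)"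
    by (simp_all add: numeral_2_eq_2 numeral_3_eq_3)
  show ?case
    unfolding prod.lessThan_Suc[of _ "Suc n"] Suc.IH P C power_add
    unfolding prod_diff_powers by (simp only: mult_ac)
qed

lemma choose_two_add: "(i + j) choose 2 = (i choose 2) + (j choose 2) + i * j"
  by (induction j) (auto simp: numeral_2_eq_2)

text \<open>The hockey-stick identity, giving the exponent of \<open>q\<close> contributed by the
  row factors and again by the column factors.\<close>

lemma sum_choose_two: "(\<Sum>i<n. i choose 2) = n choose 3"
  by (induction n) (auto simp: numeral_2_eq_2 numeral_3_eq_3)

text \<open>The 3 in the exponent counts three equal contributions: row factors, column factors and
  the Vandermonde product in the nodes \<open>q ^ i\<close>.\<close>

lemma hankel_det_q_power_choose:
  fixes q c :: "'a::comm_ring_1"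
  shows "hankel_det n (\<lambda>k. c * q ^ (k choose 2)) =
    c ^ (n + 1) * (- 1) ^ ((n + 1) choose 2) * q ^ (3 * ((n + 1) choose 3))
      * (\<Prod>j=1..n. (1 - q ^ j) ^ (n + 1 - j))"
proof -
  have "hankel_det n (\<lambda>k. c * q ^ (k choose 2)) =
      det (mat (n + 1) (n + 1)
        (\<lambda>(i, j). (c * q ^ (i choose 2)) * q ^ (j choose 2) * (q ^ i) ^ j))"
    unfolding hankel_det_def
    by (intro arg_cong[where f = det] cong_mat)
      (auto simp: choose_two_add power_add power_mult mult_ac)
  also have "\<dots> = c ^ (n + 1) * q ^ (n + 1 choose 3) * q ^ (n + 1 choose 3)
      * (\<Prod>j<Suc n. \<Prod>i<j. q ^ j - q ^ i)"
    unfolding det_scale_rows_cols det_vandermonde prod.distrib power_sum[symmetric] sum_choose_two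
    by simp
  also have "\<dots> = c ^ (n + 1) * (- 1) ^ ((n + 1) choose 2) * q ^ (3 * ((n + 1) choose 3))
      * (\<Prod>j=1..n. (1 - q ^ j) ^ (n + 1 - j))"
  proof -
    have three: "3 * m = m + m + m" for m :: nat
      by simp
    show ?thesis
      unfolding Suc_eq_plus1[symmetric] prod_prod_diff_powers three power_add
      by (simp only: mult_ac)
  qed
  finally show ?thesis .
qed

text \<open>The quotient is some \<open>P / P\<close>, and the assumption gives
  \<open>P \<noteq> 0\<close>.\<close>

lemma q_binomial_self:
  fixes q :: "'a::field"
  assumes "\<And>k. k \<ge> 1 \<Longrightarrow> q ^ k \<noteq> 1"
  shows "q_binomial q k k = 1"
proof -
  have "1 - q * q ^ i \<noteq> 0" for i
    using assms[of "Suc i"] by simp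
  then show ?thesis
    by (simp add: q_binomial_def q_pochhammer_def)
qed

lemma degree_alpha_poly_le: "degree (alpha_poly q \<alpha> k) \<le> k"
  unfolding alpha_poly_def
  by (intro degree_sum_le) (auto intro: order_trans[OF degree_monom_le])

lemma coeff_alpha_poly_top:
  assumes "\<And>k. k \<ge> 1 \<Longrightarrow> q ^ k \<noteq> 1"
  shows "coeff (alpha_poly q \<alpha> k) k = \<alpha> 0 * q ^ (k choose 2)"
  by (simp add: alpha_poly_def coeff_sum q_binomial_self[OF assms] mult.commute
      if_distrib[of "\<lambda>x. x = _"] cong: if_cong)

theorem theorem1p4:
  fixes q :: "'a::field" and \<alpha> :: "nat \<Rightarrow> 'a" and n :: nat
  assumes q_generic: "\<And>k. k \<ge> 1 \<Longrightarrow> q ^ k \<noteq> 1"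
  shows "degree (hankel_det n (alpha_poly q \<alpha>)) \<le> n * (n + 1)
    \<and> coeff (hankel_det n (alpha_poly q \<alpha>)) (n * (n + 1)) =
      \<alpha> 0 ^ (n + 1) * (- 1) ^ ((n + 1) choose 2) * q ^ (3 * ((n + 1) choose 3))
        * (\<Prod>j=1..n. (1 - q ^ j) ^ (n + 1 - j))
    \<and> (\<alpha> 0 \<noteq> 0 \<and> q \<noteq> 0 \<longrightarrow>
      degree (hankel_det n (alpha_poly q \<alpha>)) = n * (n + 1))"
proof -
  let ?H = "hankel_det n (alpha_poly q \<alpha>)"
  \<comment> \<open>With row weights \<open>i\<close> and column weights \<open>j\<close>, this is
    the total degree bound of a Leibniz term.\<close>
  have D: "(\<Sum>i<n + 1. i) + (\<Sum>j<n + 1. j) = n * (n + 1)"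
    by (induction n) auto
  note bounds = det_degree_bounds[of "n + 1" "\<lambda>i j. alpha_poly q \<alpha> (i + j)" "\<lambda>i. i" "\<lambda>j. j",
      OF degree_alpha_poly_le, unfolded D]
  have deg: "degree ?H \<le> n * (n + 1)"
    using bounds(1) unfolding hankel_det_def .
  have "coeff ?H (n * (n + 1)) = hankel_det n (\<lambda>k. \<alpha> 0 * q ^ (k choose 2))"
    using bounds(2) by (simp only: hankel_det_def coeff_alpha_poly_top[OF q_generic])
  then have coeff: "coeff ?H (n * (n + 1)) =
      \<alpha> 0 ^ (n + 1) * (- 1) ^ ((n + 1) choose 2) * q ^ (3 * ((n + 1) choose 3))
        * (\<Prod>j=1..n. (1 - q ^ j) ^ (n + 1 - j))"
    unfolding hankel_det_q_power_choose .
  \<comment> \<open>In a field the top coefficient is nonzero once \<open>\<alpha> 0\<close>,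
    \<open>q\<close> and all \<open>1 - q ^ j\<close> are.\<close>
  have "degree ?H = n * (n + 1)" if "\<alpha> 0 \<noteq> 0" "q \<noteq> 0"
  proof -
    have "(1 - q ^ j) ^ (n + 1 - j) \<noteq> 0" if "j \<in> {1..n}" for j
      using q_generic[of j] that by simp
    then have "(\<Prod>j=1..n. (1 - q ^ j) ^ (n + 1 - j)) \<noteq> 0"
      unfolding prod_zero_iff[OF finite_atLeastAtMost] by blast
    then have "coeff ?H (n * (n + 1)) \<noteq> 0"
      unfolding coeff using that by simp
    then show ?thesis
      using deg le_degree by (intro antisym)
  qed
  then show ?thesis using deg coeff by blast
qed

end
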